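(* Let $a_j>0$, $\alpha_j>-1$ for $j=1,2$ and let $u>0$. Then $$G^{2,0}_{0,2}\left[a_1a_2u\,\Big|\,{\text{--}\atop \alpha_1,\ \alpha_2}\right]=a_1^{\alpha_1}a_2^{\alpha_2}u^{\alpha_1}\int_{0}^{\infty}v^{\alpha_2-\alpha_1-1}e^{-a_1u/v-a_2v}\,dv=a_1^{\alpha_1}a_2^{\alpha_2}u^{\alpha_2}\int_0^{\infty}v^{\alpha_1-\alpha_2-1}e^{-a_1v-a_2u/v}\,dv .$$ If moreover $\alpha_1-\alpha_2\ne\pm\nu$ for all $\nu=0,1,\dots$, then these also equal $$(a_1a_2u)^{\alpha_1}\,\Gamma(\alpha_2-\alpha_1)\,{}_0F_1(\ ;1+\alpha_1-\alpha_2;a_1a_2u)+(a_1a_2u)^{\alpha_2}\,\Gamma(\alpha_1-\alpha_2)\,{}_0F_1(\ ;1+\alpha_2-\alpha_1;a_1a_2u).$$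
   Context: Meijer G-function: for $z>0$, $$G^{2,0}_{0,2}\left[z\,\Big|\,{\text{--}\atop \alpha_1,\ \alpha_2}\right]=\frac1{2\pi i}\int_{\kappa-i\infty}^{\kappa+i\infty}\Gamma(\alpha_1+s)\Gamma(\alpha_2+s)\,z^{-s}\,ds,\qquad \kappa>\max(-\alpha_1,-\alpha_2).$$ ${}_0F_1(\ ;b;z)=\sum_{k\ge0}\frac{z^k}{(b)_k\,k!}$ with $(b)_k=b(b+1)\cdots(b+k-1)$. *)

theory Defs
  imports "HOL-Analysis.Analysis"
begin

text \<open>
  The integral of \<open>f s ds\<close> over the vertical line from \<open>\<kappa> - \<i>\<infinity>\<close> to \<open>\<kappa> + \<i>\<infinity>\<close>, parametrised
  by \<open>s = \<kappa> + \<i> t\<close>; the last factor \<open>\<i>\<close> is \<open>ds/dt\<close>. It is taken in the sense of absolute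
  convergence.
\<close>

definition vline_integrable :: "real \<Rightarrow> (complex \<Rightarrow> complex) \<Rightarrow> bool" where
  "vline_integrable \<kappa> f \<longleftrightarrow> integrable lborel (\<lambda>t::real. f (Complex \<kappa> t) * \<i>)"

definition vline_integral :: "real \<Rightarrow> (complex \<Rightarrow> complex) \<Rightarrow> complex" where
  "vline_integral \<kappa> f = (LBINT t. f (Complex \<kappa> t) * \<i>)"

definition meijer_G2002_integrand :: "real \<Rightarrow> real \<Rightarrow> real \<Rightarrow> complex \<Rightarrow> complex" where
  "meijer_G2002_integrand \<alpha>1 \<alpha>2 z s =
     Gamma (of_real \<alpha>1 + s) * Gamma (of_real \<alpha>2 + s) * of_real z powr (- s)"

text \<open>
  \<open>G\<^sup>2\<^sup>,\<^sup>0\<^sub>0\<^sub>,\<^sub>2\<close> with lower parameters \<open>\<alpha>1, \<alpha>2\<close> at \<open>z > 0\<close>. The abscissa \<open>\<kappa>\<close> of the contour is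
  an explicit argument; the function is meant for every \<open>\<kappa> > max (- \<alpha>1) (- \<alpha>2)\<close>.
\<close>

definition meijer_G2002 :: "real \<Rightarrow> real \<Rightarrow> real \<Rightarrow> real \<Rightarrow> complex" where
  "meijer_G2002 \<kappa> \<alpha>1 \<alpha>2 z =
     1 / (2 * of_real pi * \<i>) * vline_integral \<kappa> (meijer_G2002_integrand \<alpha>1 \<alpha>2 z)"

definition hypergeo_0F1 :: "real \<Rightarrow> real \<Rightarrow> real" where
  "hypergeo_0F1 b z = (\<Sum>k. z ^ k / (pochhammer b k * fact k))"

end

theory Submission
  imports Defs "HOL-Complex_Analysis.Residue_Theorem" "HOL-Probability.Sinc_Integral"
begin

text \<open>
The contour integral of a product of Gamma functions against \<open>z\<^sup>-\<^sup>s\<close> is evaluated by moving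
the line of integration to the left. For a finite nonempty family of parameters \<open>\<alpha>\<^sub>i\<close> whose pairwise
differences are not integers, the integrand has simple poles at \<open>- \<alpha>\<^sub>i - n\<close>. By the functional
equation of Gamma, a shift by \<open>n\<close> multiplies the modulus by at most \<open>z\<^sup>n\<close> divided by a product of
Pochhammer symbols, which grow faster; hence the shifted integrals tend to 0 and the original one
is given by the sum of all residues
(\<open>barnes_vline_integral_eq_slater_series\<close>, Slater's theorem for \<open>G\<^sup>m\<^sup>,\<^sup>0\<^sub>0\<^sub>,\<^sub>m\<close>).

This is used twice. For two parameters the two families of residues are the two \<open>\<^sub>0F\<^sub>1\<close> series
(\<open>meijer_G2002_eq_0F1\<close>). For one parameter the residues form an exponential series and give the
Cahen-Mellin formula, by which the contour integral of \<open>\<Gamma>(\<alpha> + s) z\<^sup>-\<^sup>s\<close> is \<open>2\<pi>i z\<^sup>\<alpha> e\<^sup>-\<^sup>z\<close>.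

The integral representations hold for all parameters and come from the one-parameter case: write
\<open>\<Gamma>(\<alpha>\<^sub>2 + s)\<close> as Euler's integral of \<open>y powr (\<alpha>\<^sub>2 + s - 1) * exp (- y)\<close>, exchange the integrals by
Fubini, and apply Cahen-Mellin at \<open>z / y\<close> to the inner contour integral
(\<open>meijer_G2002_eq_Laplace_type_integral\<close>). The substitution \<open>y = a\<^sub>2 v\<close> gives the first stated
integral, and the symmetry of the integrand in \<open>\<alpha>\<^sub>1, \<alpha>\<^sub>2\<close>, used together with an exchange of \<open>a\<^sub>1\<close>
and \<open>a\<^sub>2\<close>, gives the second.
\<close>

section \<open>Bounds for the Gamma function on vertical lines and strips\<close>

text \<open>
The triangle inequality for Euler's integral, since \<open>t powr (s - 1)\<close> has modulus \<open>t powr (Re s - 1)\<close>.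
\<close>

lemma norm_Gamma_le_Gamma_Re:
  assumes "Re s > 0"
  shows "norm (Gamma s) \<le> Gamma (Re s)"
proof -
  have c: "((\<lambda>t. of_real t powr (s - 1) / of_real (exp t)) has_integral Gamma s) {0..}"
    using assms by (rule Gamma_integral_complex)
  have r: "((\<lambda>t. t powr (Re s - 1) / exp t) has_integral Gamma (Re s)) {0..}"
    using assms by (rule Gamma_integral_real)
  have "norm (integral {0..} (\<lambda>t. complex_of_real t powr (s - 1) / of_real (exp t)))
        \<le> integral {0..} (\<lambda>t. t powr (Re s - 1) / exp t)"
    using c r
    by (intro integral_norm_bound_integral)
       (auto simp: has_integral_iff norm_divide norm_powr_real_powr)
  thus ?thesis
    using c r by (simp add: has_integral_iff)
qed

lemma Gamma_shift_nat:
  fixes s :: "'a :: Gamma"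
  assumes "s \<notin> \<int>\<^sub>\<le>\<^sub>0"
  shows "Gamma s = Gamma (s + of_nat n) / pochhammer s n"
proof -
  have "pochhammer s n \<noteq> 0"
    using assms pochhammer_eq_0_imp_nonpos_Int by blast
  with pochhammer_Gamma[OF assms, of n] assms show ?thesis
    by (simp add: Gamma_eq_zero_iff field_simps)
qed

lemma pochhammer_abs_Re_le_norm: "\<bar>pochhammer (Re s) n\<bar> \<le> norm (pochhammer s n)"
proof -
  have "\<bar>Re s + real j\<bar> \<le> norm (s + of_nat j)" for j
    using abs_Re_le_cmod[of "s + of_nat j"] by simp
  thus ?thesis
    unfolding pochhammer_prod abs_prod prod_norm[symmetric] by (intro prod_mono) auto
qed

lemma power_abs_Im_le_norm_pochhammer: "\<bar>Im s\<bar> ^ n \<le> norm (pochhammer s n)"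
proof -
  have "\<bar>Im s\<bar> \<le> norm (s + of_nat j)" for j
    using abs_Im_le_cmod[of "s + of_nat j"] by simp
  hence "(\<Prod>j<n. \<bar>Im s\<bar>) \<le> (\<Prod>j<n. norm (s + of_nat j))"
    by (intro prod_mono) auto
  thus ?thesis
    by (simp add: pochhammer_prod prod_norm[symmetric] lessThan_atLeast0)
qed

lemma Complex_notin_nonpos_Ints: "t \<noteq> 0 \<or> x \<notin> \<int>\<^sub>\<le>\<^sub>0 \<Longrightarrow> Complex x t \<notin> \<int>\<^sub>\<le>\<^sub>0"
  by (auto elim!: nonpos_Ints_cases' simp: complex_eq_iff)

text \<open>
Quadratic decay replaces Stirling's formula, which would give exponential decay. Shift the strip
into the right half-plane by \<open>n \<ge> 2\<close> units: there Gamma is bounded by its values on a compact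
real interval, and each of the \<open>n\<close> factors paid for the shift has modulus at least \<open>\<bar>t\<bar>\<close>.
\<close>

lemma Gamma_strip_bound:
  obtains C where "C \<ge> 0"
    "\<And>x t. a \<le> x \<Longrightarrow> x \<le> b \<Longrightarrow> \<bar>t\<bar> \<ge> 1 \<Longrightarrow> norm (Gamma (Complex x t)) \<le> C / t\<^sup>2"
proof (cases "a \<le> b")
  case False
  thus ?thesis by (intro that[of 0]) auto
next
  case True
  \<comment> \<open>At least 2 for the decay \<open>1 / t\<^sup>2\<close>, and so large that \<open>a + n > 0\<close>.\<close>
  define n where "n = max 2 (nat \<lceil>1 - a\<rceil>)"
  have n: "n \<ge> 2" "a + real n > 0"
    unfolding n_def by linarith+
  have "continuous_on {a + real n..b + real n} (Gamma :: real \<Rightarrow> real)"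
    using n by (intro continuous_on_Gamma) (auto elim!: nonpos_Ints_cases')
  from continuous_attains_sup[OF _ _ this] True obtain y where
    y: "y \<in> {a + real n..b + real n}" "\<And>x. x \<in> {a + real n..b + real n} \<Longrightarrow> Gamma x \<le> Gamma y"
    by auto
  show ?thesis
  proof (rule that[of "Gamma y"])
    show y0: "Gamma y \<ge> 0"
      using y n by (intro less_imp_le Gamma_real_pos) auto
    fix x t :: real
    assume x: "a \<le> x" "x \<le> b" and t: "\<bar>t\<bar> \<ge> 1"
    let ?s = "Complex x t"
    have "Gamma ?s = Gamma (?s + of_nat n) / pochhammer ?s n"
      using t by (intro Gamma_shift_nat Complex_notin_nonpos_Ints) auto
    hence "norm (Gamma ?s) = norm (Gamma (?s + of_nat n)) / norm (pochhammer ?s n)"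
      by (simp add: norm_divide)
    also have "\<dots> \<le> Gamma y / t\<^sup>2"
    proof (rule frac_le)
      have "norm (Gamma (?s + of_nat n)) \<le> Gamma (Re (?s + of_nat n))"
        using x n by (intro norm_Gamma_le_Gamma_Re) auto
      also have "\<dots> \<le> Gamma y"
        using x by (intro y(2)) auto
      finally show "norm (Gamma (?s + of_nat n)) \<le> Gamma y" .
      have "t\<^sup>2 = \<bar>t\<bar> ^ 2" by simp
      also have "\<dots> \<le> \<bar>t\<bar> ^ n"
        using t n by (intro power_increasing) auto
      also have "\<dots> \<le> norm (pochhammer ?s n)"
        using power_abs_Im_le_norm_pochhammer[of ?s n] by simp
      finally show "t\<^sup>2 \<le> norm (pochhammer ?s n)" .
      show "0 < t\<^sup>2" using t by auto
    qed (use y0 in auto)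
    finally show "norm (Gamma ?s) \<le> Gamma y / t\<^sup>2" .
  qed
qed

lemma continuous_on_Gamma_vertical:
  assumes "x \<notin> \<int>\<^sub>\<le>\<^sub>0"
  shows "continuous_on A (\<lambda>t. Gamma (Complex x t))"
proof -
  have "continuous_on A (\<lambda>t. Complex x t)"
    unfolding Complex_eq by (intro continuous_intros)
  thus ?thesis
    using assms Complex_notin_nonpos_Ints
    by (intro continuous_on_compose2[OF continuous_on_Gamma[of "Complex x ` UNIV"]]) auto
qed

lemma Gamma_vertical_bound:
  assumes "x \<notin> \<int>\<^sub>\<le>\<^sub>0"
  obtains C where "C \<ge> 0" "\<And>t. norm (Gamma (Complex x t)) \<le> C / (1 + t\<^sup>2)"
proof -
  obtain C where C: "C \<ge> 0" "\<And>t. \<bar>t\<bar> \<ge> 1 \<Longrightarrow> norm (Gamma (Complex x t)) \<le> C / t\<^sup>2"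
    using Gamma_strip_bound[of x x] by (metis order_refl)
  have "continuous_on {-1..1} (\<lambda>t. norm (Gamma (Complex x t)))"
    using assms by (intro continuous_on_norm continuous_on_Gamma_vertical)
  from continuous_attains_sup[OF _ _ this] obtain y where
    y: "\<forall>t\<in>{-1..1}. norm (Gamma (Complex x t)) \<le> norm (Gamma (Complex x y))"
    by force
  define D where "D = norm (Gamma (Complex x y))"
  have D: "\<And>t. t \<in> {-1..1} \<Longrightarrow> norm (Gamma (Complex x t)) \<le> D"
    using y by (simp add: D_def)
  have D0: "D \<ge> 0"
    by (simp add: D_def)
  show ?thesis
  proof (rule that[of "2 * C + 2 * D"])
    fix t :: real
    have pos: "1 + t\<^sup>2 > 0" by (simp add: add_pos_nonneg)
    show "norm (Gamma (Complex x t)) \<le> (2 * C + 2 * D) / (1 + t\<^sup>2)"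
    proof (cases "\<bar>t\<bar> \<ge> 1")
      case True
      hence t2: "t\<^sup>2 \<ge> 1" using abs_le_square_iff[of 1 t] by simp
      have "norm (Gamma (Complex x t)) \<le> C / t\<^sup>2" using True by (rule C)
      also have "C / t\<^sup>2 = (2 * C) / (t\<^sup>2 + t\<^sup>2)"
        by simp
      also have "\<dots> \<le> (2 * C) / (1 + t\<^sup>2)"
        using t2 C(1) pos by (intro divide_left_mono add_right_mono mult_pos_pos) auto
      also have "\<dots> \<le> (2 * C + 2 * D) / (1 + t\<^sup>2)"
        using D0 pos by (intro divide_right_mono) auto
      finally show ?thesis .
    next
      case False
      hence t2: "1 + t\<^sup>2 \<le> 2"
        using abs_square_le_1[of t] by simp
      have "norm (Gamma (Complex x t)) \<le> D" using False by (intro D) auto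
      also have "\<dots> \<le> (2 * D) / (1 + t\<^sup>2)"
        using mult_left_mono[OF t2 D0] pos by (simp add: field_simps)
      also have "\<dots> \<le> (2 * C + 2 * D) / (1 + t\<^sup>2)"
        using C(1) pos by (intro divide_right_mono) auto
      finally show ?thesis .
    qed
  qed (use C D0 in auto)
qed

text \<open>
The factor \<open>pochhammer (p - n) n\<close> of the functional equation agrees up to sign with
\<open>pochhammer (1 - p) n\<close>; in this form its growth in \<open>n\<close> is visible.
\<close>

lemma norm_Gamma_shift_left_le:
  assumes "p \<notin> \<int>"
  shows "norm (Gamma (Complex (p - real n) t)) \<le> norm (Gamma (Complex p t)) / \<bar>pochhammer (1 - p) n\<bar>"
proof -
  have pn: "p - real n \<notin> \<int>" using assms by auto
  hence s: "Complex (p - real n) t \<notin> \<int>\<^sub>\<le>\<^sub>0"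
    by (intro Complex_notin_nonpos_Ints) auto
  have eq: "Complex (p - real n) t + of_nat n = Complex p t"
    by (simp add: complex_eq_iff)
  have nz: "pochhammer (p - real n) n \<noteq> 0"
    using pn pochhammer_eq_0_imp_nonpos_Int by fastforce
  have "\<bar>pochhammer (p - real n) n\<bar> = \<bar>pochhammer (1 - p) n\<bar>"
    using pochhammer_minus[of "p - 1" n] by (simp add: abs_mult power_abs)
  moreover have "\<bar>pochhammer (p - real n) n\<bar> \<le> norm (pochhammer (Complex (p - real n) t) n)"
    using pochhammer_abs_Re_le_norm[of "Complex (p - real n) t"] by simp
  ultimately show ?thesis
    using nz by (subst Gamma_shift_nat[OF s, of n]) (auto simp: norm_divide eq intro!: divide_left_mono mult_pos_pos)
qed

lemma power_over_pochhammer_tendsto_0: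
  fixes b x :: real
  assumes "b \<notin> \<int>\<^sub>\<le>\<^sub>0"
  shows "(\<lambda>n. x ^ n / pochhammer b n) \<longlonglongrightarrow> 0"
proof -
  have nz: "pochhammer b n \<noteq> 0" for n
    using assms pochhammer_eq_0_imp_nonpos_Int by blast
  define N where "N = nat \<lceil>2 * \<bar>x\<bar> + \<bar>b\<bar>\<rceil>"
  have "summable (\<lambda>n. x ^ n / pochhammer b n)"
  proof (rule summable_ratio_test[where c = "1/2" and N = N])
    fix n assume n: "n \<ge> N"
    hence "real n \<ge> 2 * \<bar>x\<bar> + \<bar>b\<bar>" unfolding N_def by linarith
    hence "2 * \<bar>x\<bar> \<le> \<bar>b + real n\<bar>" by linarith
    moreover have "b + real n \<noteq> 0" using nz[of "Suc n"] by (simp add: pochhammer_Suc)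
    ultimately have "\<bar>x\<bar> / \<bar>b + real n\<bar> \<le> 1 / 2" by (simp add: field_simps)
    hence "(\<bar>x\<bar> / \<bar>b + real n\<bar>) * norm (x ^ n / pochhammer b n) \<le> 1 / 2 * norm (x ^ n / pochhammer b n)"
      by (rule mult_right_mono) auto
    thus "norm (x ^ Suc n / pochhammer b (Suc n)) \<le> 1 / 2 * norm (x ^ n / pochhammer b n)"
      by (simp add: pochhammer_Suc abs_mult abs_divide mult_ac)
  qed auto
  thus ?thesis by (rule summable_LIMSEQ_zero)
qed

lemma integrable_Cauchy_density: "integrable lborel (\<lambda>t::real. 1 / (1 + t\<^sup>2))"
  using integrable_inverse_1_plus_square
  by (simp add: set_integrable_def divide_inverse einterval_eq_UNIV)

section \<open>Shifting a vertical line of integration across poles\<close>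

lemma contour_integral_tendsto_vline_integral:
  assumes "vline_integrable c f"
  shows "(\<lambda>n. contour_integral (linepath (Complex c (- real n)) (Complex c (real n))) f)
           \<longlonglongrightarrow> vline_integral c f"
proof -
  let ?h = "\<lambda>t. f (Complex c t) * \<i>"
  have int: "integrable lborel ?h"
    using assms by (simp add: vline_integrable_def)
  have "(\<lambda>n. LINT t|lborel. indicator {- real n..real n} t *\<^sub>R ?h t) \<longlonglongrightarrow> (LINT t|lborel. ?h t)"
  proof (rule integral_dominated_convergence[where w = "\<lambda>t. norm (?h t)"])
    show "AE t in lborel. (\<lambda>n. indicator {- real n..real n} t *\<^sub>R ?h t) \<longlonglongrightarrow> ?h t"
    proof (rule AE_I2)
      fix t :: real
      have "eventually (\<lambda>n. indicator {- real n..real n} t *\<^sub>R ?h t = ?h t) sequentially"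
        using eventually_ge_at_top[of "nat \<lceil>\<bar>t\<bar>\<rceil>"]
      proof eventually_elim
        case (elim n)
        hence "t \<in> {- real n..real n}" by (simp, linarith)
        thus ?case by simp
      qed
      thus "(\<lambda>n. indicator {- real n..real n} t *\<^sub>R ?h t) \<longlonglongrightarrow> ?h t"
        by (rule tendsto_eventually)
    qed
    show "AE t in lborel. norm (indicator {- real n..real n} t *\<^sub>R ?h t) \<le> norm (?h t)" for n
      by (intro AE_I2) (simp add: indicator_def)
    show "integrable lborel (\<lambda>t. norm (?h t))"
      using int by (rule integrable_norm)
    show "?h \<in> borel_measurable lborel"
      using int by (rule borel_measurable_integrable)
    thus "(\<lambda>t. indicator {- real n..real n} t *\<^sub>R ?h t) \<in> borel_measurable lborel" for n
      by (intro borel_measurable_scaleR borel_measurable_indicator) auto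
  qed
  moreover have "eventually (\<lambda>n. (LINT t|lborel. indicator {- real n..real n} t *\<^sub>R ?h t) =
     contour_integral (linepath (Complex c (- real n)) (Complex c (real n))) f) sequentially"
    using eventually_gt_at_top[of 0]
  proof eventually_elim
    case (elim n)
    have "set_integrable lborel {- real n..real n} ?h"
      unfolding set_integrable_def using int by (intro integrable_mult_indicator) auto
    from set_borel_integral_eq_integral(2)[OF this]
    have "(LINT t|lborel. indicator {- real n..real n} t *\<^sub>R ?h t) = integral {- real n..real n} ?h"
      unfolding set_lebesgue_integral_def .
    also have "\<dots> = \<i> * integral {- real n..real n} (\<lambda>t. f (Complex c t))"
      by (simp add: mult.commute)
    also have "\<dots> = contour_integral (linepath (Complex c (- real n)) (Complex c (real n))) f"
      using elim by (subst contour_integral_linepath_same_Re[where c = c]) auto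
    finally show ?case .
  qed
  ultimately show ?thesis
    unfolding vline_integral_def by (rule Lim_transform_eventually)
qed

lemma contour_integral_rectpath_split:
  assumes "continuous_on (path_image (rectpath (Complex c (-T)) (Complex k T))) g"
    and "c \<le> k" "0 \<le> T"
  shows "contour_integral (rectpath (Complex c (-T)) (Complex k T)) g =
           contour_integral (linepath (Complex c (-T)) (Complex k (-T))) g
         + contour_integral (linepath (Complex k (-T)) (Complex k T)) g
         - contour_integral (linepath (Complex c T) (Complex k T)) g
         - contour_integral (linepath (Complex c (-T)) (Complex c T)) g"
proof -
  let ?a1 = "Complex c (-T)" and ?a2 = "Complex k (-T)" and ?a3 = "Complex k T" and ?a4 = "Complex c T"
  have img: "path_image (rectpath ?a1 ?a3) =
      closed_segment ?a1 ?a2 \<union> closed_segment ?a2 ?a3 \<union> closed_segment ?a3 ?a4 \<union> closed_segment ?a4 ?a1"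
    by (simp add: rectpath_def Let_def path_image_join Un_assoc)
  have i: "g contour_integrable_on linepath ?a1 ?a2" "g contour_integrable_on linepath ?a2 ?a3"
          "g contour_integrable_on linepath ?a3 ?a4" "g contour_integrable_on linepath ?a4 ?a1"
    using assms(1) unfolding img
    by (auto intro!: contour_integrable_continuous_linepath elim: continuous_on_subset)
  have r: "contour_integral (linepath ?a3 ?a4) g = - contour_integral (linepath ?a4 ?a3) g"
          "contour_integral (linepath ?a4 ?a1) g = - contour_integral (linepath ?a1 ?a4) g"
    using contour_integral_reversepath[of "linepath ?a4 ?a3" g]
          contour_integral_reversepath[of "linepath ?a1 ?a4" g] by auto
  show ?thesis
    unfolding rectpath_def Let_def using i r by (simp add: contour_integrable_join)
qed

text \<open>
The residue theorem on the rectangle with vertices \<open>c \<plusminus> iT\<close> and \<open>k \<plusminus> iT\<close>, as \<open>T \<rightarrow> \<infinity>\<close>: the horizontal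
sides vanish in the limit because of the uniform bound \<open>B\<close>. The exceptional set \<open>P\<close> may contain
poles to the left of the line \<open>Re s = c\<close>, which lie outside all rectangles; this allows a half-plane
as the domain of the residue theorem.
\<close>

lemma vline_integral_shift:
  assumes "d < c" "c < k"
    and P: "finite P" "\<And>p. p \<in> P \<Longrightarrow> Re p \<noteq> c" "\<And>p. p \<in> P \<Longrightarrow> Re p < k"
    and holo: "g holomorphic_on {s. Re s > d} - P"
    and int: "vline_integrable c g" "vline_integrable k g"
    and decay: "\<And>\<sigma> t. c \<le> \<sigma> \<Longrightarrow> \<sigma> \<le> k \<Longrightarrow> \<bar>t\<bar> \<ge> 1 \<Longrightarrow> norm (g (Complex \<sigma> t)) \<le> B \<bar>t\<bar>"
    and B: "(B \<longlongrightarrow> 0) at_top"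
  shows "vline_integral k g - vline_integral c g =
           2 * pi * \<i> * (\<Sum>p | p \<in> P \<and> c < Re p. residue g p)"
proof -
  define T where "T = (\<lambda>n::nat. real n)"
  define bot where "bot = (\<lambda>n. contour_integral (linepath (Complex c (-T n)) (Complex k (-T n))) g)"
  define top where "top = (\<lambda>n. contour_integral (linepath (Complex c (T n)) (Complex k (T n))) g)"
  define lft where "lft = (\<lambda>n. contour_integral (linepath (Complex c (-T n)) (Complex c (T n))) g)"
  define rgt where "rgt = (\<lambda>n. contour_integral (linepath (Complex k (-T n)) (Complex k (T n))) g)"
  have ev_P: "eventually (\<lambda>n. \<forall>p\<in>P. \<bar>Im p\<bar> < T n) sequentially"
  proof (intro eventually_ball_finite P(1) ballI)
    fix p show "eventually (\<lambda>n. \<bar>Im p\<bar> < T n) sequentially"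
      using eventually_gt_at_top[of "nat \<lceil>\<bar>Im p\<bar>\<rceil>"]
      by eventually_elim (simp add: T_def, linarith)
  qed
  have ev_T: "eventually (\<lambda>n. T n \<ge> 1) sequentially"
    using eventually_ge_at_top[of 1] by eventually_elim (simp add: T_def)
  have cont: "continuous_on A g" if "A \<subseteq> {s. Re s > d} - P" for A
    using holo that by (metis continuous_on_subset holomorphic_on_imp_continuous_on)
  have res: "eventually (\<lambda>n. bot n + rgt n - top n - lft n =
          2 * pi * \<i> * (\<Sum>p | p \<in> P \<and> c < Re p. residue g p)) sequentially"
    using ev_P ev_T
  proof eventually_elim
    case (elim n)
    let ?r = "rectpath (Complex c (-T n)) (Complex k (T n))"
    let ?bx = "box (Complex c (-T n)) (Complex k (T n))"
    let ?cb = "cbox (Complex c (-T n)) (Complex k (T n))"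
    have img: "path_image ?r = ?cb - ?bx"
      using assms(2) elim by (intro path_image_rectpath_cbox_minus_box) auto
    have sub: "path_image ?r \<subseteq> {s. Re s > d} - P"
    proof
      fix s assume s: "s \<in> path_image ?r"
      hence "c \<le> Re s" by (auto simp: img in_cbox_complex_iff)
      moreover have "s \<notin> P"
      proof
        assume "s \<in> P"
        hence "\<bar>Im s\<bar> < T n" "Re s \<noteq> c" "Re s < k" using elim P by auto
        with s show False by (auto simp: img in_cbox_complex_iff in_box_complex_iff)
      qed
      ultimately show "s \<in> {s. Re s > d} - P" using assms(1) by auto
    qed
    have "contour_integral ?r g = 2 * pi * \<i> * (\<Sum>p\<in>P. winding_number ?r p * residue g p)"
    proof (rule Residue_theorem)
      show "open {s. Re s > d}" by (rule open_halfspace_Re_gt)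
      show "connected {s. Re s > d}" by (intro convex_connected convex_halfspace_Re_gt)
      show "finite P" "g holomorphic_on {s. d < Re s} - P" by fact+
      show "path_image ?r \<subseteq> {s. Re s > d} - P" by fact
      show "\<forall>z. z \<notin> {s. Re s > d} \<longrightarrow> winding_number ?r z = 0"
        using assms(1,2) elim
        by (intro allI impI winding_number_rectpath_outside) (auto simp: in_cbox_complex_iff)
    qed auto
    also have "(\<Sum>p\<in>P. winding_number ?r p * residue g p) =
               (\<Sum>p\<in>P. if c < Re p then residue g p else 0)"
    proof (intro sum.cong refl)
      fix p assume p: "p \<in> P"
      hence *: "\<bar>Im p\<bar> < T n" "Re p \<noteq> c" "Re p < k" using elim P by auto
      show "winding_number ?r p * residue g p = (if c < Re p then residue g p else 0)"
      proof (cases "c < Re p")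
        case True
        with * have "p \<in> ?bx" by (auto simp: in_box_complex_iff)
        thus ?thesis using True by (simp add: winding_number_rectpath)
      next
        case False
        hence "p \<notin> ?cb" using * by (auto simp: in_cbox_complex_iff)
        hence "winding_number ?r p = 0"
          using elim assms(2) by (intro winding_number_rectpath_outside) auto
        thus ?thesis using False by simp
      qed
    qed
    also have "\<dots> = (\<Sum>p | p \<in> P \<and> c < Re p. residue g p)"
      using P(1) by (simp add: sum.inter_filter)
    also have "contour_integral ?r g = bot n + rgt n - top n - lft n"
      unfolding bot_def rgt_def top_def lft_def
      using assms(2) elim by (intro contour_integral_rectpath_split cont sub) auto
    finally show ?case .
  qed
  have seg: "norm (contour_integral (linepath (Complex c t) (Complex k t)) g) \<le> B \<bar>t\<bar> * (k - c)"
    if t: "\<bar>t\<bar> \<ge> 1" "\<forall>p\<in>P. \<bar>Im p\<bar> < \<bar>t\<bar>" for t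
  proof -
    have on_seg: "c \<le> Re s \<and> Re s \<le> k \<and> Im s = t" if "s \<in> closed_segment (Complex c t) (Complex k t)" for s
      using that assms(2) by (auto simp: closed_segment_same_Im closed_segment_eq_real_ivl)
    have "norm (contour_integral (linepath (Complex c t) (Complex k t)) g)
           \<le> B \<bar>t\<bar> * norm (Complex k t - Complex c t)"
    proof (rule contour_integral_bound_linepath)
      show "g contour_integrable_on linepath (Complex c t) (Complex k t)"
        using on_seg t assms(1) by (intro contour_integrable_continuous_linepath cont) force
      show "0 \<le> B \<bar>t\<bar>"
        using decay[of c t] t assms(2) norm_ge_zero[of "g (Complex c t)"] by linarith
      fix s assume "s \<in> closed_segment (Complex c t) (Complex k t)"
      from on_seg[OF this] have "s = Complex (Re s) t" "c \<le> Re s" "Re s \<le> k"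
        by (auto simp: complex_eq_iff)
      thus "norm (g s) \<le> B \<bar>t\<bar>"
        using decay t(1) by metis
    qed
    also have "norm (Complex k t - Complex c t) = k - c"
      using assms(2) by (simp add: cmod_def)
    finally show ?thesis .
  qed
  have BT: "(\<lambda>n. B (T n) * (k - c)) \<longlonglongrightarrow> 0"
    unfolding T_def
    using tendsto_mult_right[OF filterlim_compose[OF B filterlim_real_sequentially], of "k - c"] by simp
  have "bot \<longlonglongrightarrow> 0"
  proof (rule Lim_null_comparison[OF _ BT])
    show "eventually (\<lambda>n. norm (bot n) \<le> B (T n) * (k - c)) sequentially"
      using ev_P ev_T
    proof eventually_elim
      case (elim n)
      thus ?case using seg[of "- T n"] by (simp add: bot_def)
    qed
  qed
  moreover have "top \<longlonglongrightarrow> 0"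
  proof (rule Lim_null_comparison[OF _ BT])
    show "eventually (\<lambda>n. norm (top n) \<le> B (T n) * (k - c)) sequentially"
      using ev_P ev_T
    proof eventually_elim
      case (elim n)
      thus ?case using seg[of "T n"] by (simp add: top_def)
    qed
  qed
  moreover have "lft \<longlonglongrightarrow> vline_integral c g" "rgt \<longlonglongrightarrow> vline_integral k g"
    unfolding lft_def rgt_def T_def using int by (auto intro: contour_integral_tendsto_vline_integral)
  ultimately have "(\<lambda>n. bot n + rgt n - top n - lft n) \<longlonglongrightarrow>
      0 + vline_integral k g - 0 - vline_integral c g"
    by (intro tendsto_intros)
  hence "(\<lambda>n. bot n + rgt n - top n - lft n) \<longlonglongrightarrow> vline_integral k g - vline_integral c g"
    by simp
  from LIMSEQ_unique[OF this tendsto_eventually[OF res]] show ?thesis .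
qed

section \<open>The integrand with finitely many Gamma factors\<close>

text \<open>
The Mellin-Barnes integrand of \<open>G\<^sup>m\<^sup>,\<^sup>0\<^sub>0\<^sub>,\<^sub>m\<close> with \<open>m = card I\<close>. A finite index set covers both
\<open>m = 1\<close> (the exponential function) and \<open>m = 2\<close> (the function studied here).
\<close>

definition barnes_integrand :: "'i set \<Rightarrow> ('i \<Rightarrow> real) \<Rightarrow> real \<Rightarrow> complex \<Rightarrow> complex" where
  "barnes_integrand I \<alpha> z s = (\<Prod>i\<in>I. Gamma (of_real (\<alpha> i) + s)) * of_real z powr (- s)"

lemma of_real_plus_Complex: "of_real a + Complex x t = Complex (a + x) t"
  by (simp add: complex_eq_iff)

lemma norm_barnes_integrand:
  assumes "z > 0"
  shows "norm (barnes_integrand I \<alpha> z (Complex x t)) =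
           (\<Prod>i\<in>I. norm (Gamma (Complex (\<alpha> i + x) t))) * z powr (- x)"
  using assms
  by (simp add: barnes_integrand_def norm_mult prod_norm[symmetric] norm_powr_real_powr of_real_plus_Complex)

lemma barnes_integrand_vertical_integrable:
  assumes "finite I" "I \<noteq> {}" "z > 0" and x: "\<And>i. i \<in> I \<Longrightarrow> \<alpha> i + x \<notin> \<int>\<^sub>\<le>\<^sub>0"
  shows "integrable lborel (\<lambda>t. barnes_integrand I \<alpha> z (Complex x t))"
proof -
  have "\<forall>i\<in>I. \<exists>C\<ge>0. \<forall>t. norm (Gamma (Complex (\<alpha> i + x) t)) \<le> C / (1 + t\<^sup>2)"
    using Gamma_vertical_bound[OF x] by metis
  then obtain C where C: "\<And>i. i \<in> I \<Longrightarrow> C i \<ge> 0"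
    "\<And>i t. i \<in> I \<Longrightarrow> norm (Gamma (Complex (\<alpha> i + x) t)) \<le> C i / (1 + t\<^sup>2)"
    by metis
  have "continuous_on UNIV (\<lambda>t. \<Prod>i\<in>I. Gamma (Complex (\<alpha> i + x) t))"
    using x by (intro continuous_on_prod continuous_on_Gamma_vertical) auto
  moreover have "continuous_on UNIV (\<lambda>t. of_real z powr (- Complex x t))"
    unfolding Complex_eq using assms(3) by (intro continuous_intros) auto
  ultimately have "continuous_on UNIV (\<lambda>t. barnes_integrand I \<alpha> z (Complex x t))"
    unfolding barnes_integrand_def of_real_plus_Complex by (rule continuous_on_mult)
  hence meas: "(\<lambda>t. barnes_integrand I \<alpha> z (Complex x t)) \<in> borel_measurable lborel"
    by (simp add: borel_measurable_continuous_onI)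
  show ?thesis
  proof (rule Bochner_Integration.integrable_bound)
    show "integrable lborel (\<lambda>t::real. ((\<Prod>i\<in>I. C i) * z powr (- x)) * (1 / (1 + t\<^sup>2)))"
      by (intro integrable_mult_right integrable_Cauchy_density)
    show "AE t in lborel. norm (barnes_integrand I \<alpha> z (Complex x t))
            \<le> norm (((\<Prod>i\<in>I. C i) * z powr (- x)) * (1 / (1 + t\<^sup>2)))"
    proof (rule AE_I2)
      fix t :: real
      have pos: "1 + t\<^sup>2 > 0" by (simp add: add_pos_nonneg)
      have "(\<Prod>i\<in>I. norm (Gamma (Complex (\<alpha> i + x) t))) \<le> (\<Prod>i\<in>I. C i / (1 + t\<^sup>2))"
        using C by (intro prod_mono) auto
      also have "\<dots> = (\<Prod>i\<in>I. C i) * (1 / (1 + t\<^sup>2)) ^ card I"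
        by (simp add: prod_dividef power_divide)
      also have "\<dots> \<le> (\<Prod>i\<in>I. C i) * (1 / (1 + t\<^sup>2)) ^ 1"
        using assms(1,2) C(1) pos
        by (intro mult_left_mono power_decreasing prod_nonneg) (auto simp: Suc_le_eq card_gt_0_iff)
      finally have "norm (barnes_integrand I \<alpha> z (Complex x t))
            \<le> (\<Prod>i\<in>I. C i) * (1 / (1 + t\<^sup>2)) ^ 1 * z powr (- x)"
        unfolding norm_barnes_integrand[OF assms(3)] by (rule mult_right_mono) auto
      also have "\<dots> = ((\<Prod>i\<in>I. C i) * z powr (- x)) * (1 / (1 + t\<^sup>2))"
        by (simp add: mult_ac)
      finally show "norm (barnes_integrand I \<alpha> z (Complex x t))
            \<le> norm (((\<Prod>i\<in>I. C i) * z powr (- x)) * (1 / (1 + t\<^sup>2)))"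
        by (rule order_trans) (simp only: real_norm_def abs_ge_self)
    qed
  qed (rule meas)
qed

text \<open>
The quadratic decay of each Gamma factor, uniform in the strip, as needed for the horizontal sides
of the rectangles.
\<close>

lemma barnes_integrand_strip_decay:
  assumes "finite I" "I \<noteq> {}" "z > 0"
  obtains B where "(B \<longlongrightarrow> 0) at_top"
    "\<And>\<sigma> t. c \<le> \<sigma> \<Longrightarrow> \<sigma> \<le> k \<Longrightarrow> \<bar>t\<bar> \<ge> 1 \<Longrightarrow> norm (barnes_integrand I \<alpha> z (Complex \<sigma> t)) \<le> B \<bar>t\<bar>"
proof -
  have "\<forall>i. \<exists>C. \<forall>x t. \<alpha> i + c \<le> x \<longrightarrow> x \<le> \<alpha> i + k \<longrightarrow> \<bar>t\<bar> \<ge> 1 \<longrightarrow> norm (Gamma (Complex x t)) \<le> C / t\<^sup>2"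
    using Gamma_strip_bound by metis
  then obtain C where C: "\<And>i x t. \<alpha> i + c \<le> x \<Longrightarrow> x \<le> \<alpha> i + k \<Longrightarrow> \<bar>t\<bar> \<ge> 1 \<Longrightarrow>
      norm (Gamma (Complex x t)) \<le> C i / t\<^sup>2"
    by metis
  \<comment> \<open>Whether \<open>z powr (- \<sigma>)\<close> increases or decreases depends on \<open>z\<close>; \<open>Z\<close> covers both cases.\<close>
  define Z where "Z = z powr (-c) + z powr (-k)"
  define B where "B = (\<lambda>t::real. (\<Prod>i\<in>I. C i / t\<^sup>2) * Z)"
  show ?thesis
  proof (rule that[of B])
    have "((\<lambda>t::real. C i / t\<^sup>2) \<longlongrightarrow> 0) at_top" for i
      by (intro tendsto_divide_0[OF tendsto_const] filterlim_at_top_imp_at_infinity filterlim_pow_at_top filterlim_ident) auto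
    hence "(B \<longlongrightarrow> (\<Prod>i\<in>I. 0) * Z) at_top"
      unfolding B_def by (intro tendsto_intros)
    thus "(B \<longlongrightarrow> 0) at_top"
      using assms(1,2) by (simp add: power_0_left)
    fix \<sigma> t :: real
    assume s: "c \<le> \<sigma>" "\<sigma> \<le> k" and t: "\<bar>t\<bar> \<ge> 1"
    have "z powr (-\<sigma>) \<le> Z"
    proof (cases "z \<ge> 1")
      case True
      hence "z powr (-\<sigma>) \<le> z powr (-c)" using s by (intro powr_mono) auto
      thus ?thesis using assms(3) by (simp add: Z_def add_increasing2)
    next
      case False
      hence "z powr (-\<sigma>) \<le> z powr (-k)" using s assms(3) by (intro powr_mono') auto
      thus ?thesis using assms(3) by (simp add: Z_def add_increasing)
    qed
    hence "(\<Prod>i\<in>I. norm (Gamma (Complex (\<alpha> i + \<sigma>) t))) * z powr (-\<sigma>) \<le> (\<Prod>i\<in>I. C i / t\<^sup>2) * Z"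
    proof (intro mult_mono prod_mono conjI prod_nonneg)
      fix i
      show g: "norm (Gamma (Complex (\<alpha> i + \<sigma>) t)) \<le> C i / t\<^sup>2" using s t by (intro C) auto
      show "0 \<le> C i / t\<^sup>2" by (rule order_trans[OF norm_ge_zero g])
    qed auto
    thus "norm (barnes_integrand I \<alpha> z (Complex \<sigma> t)) \<le> B \<bar>t\<bar>"
      using assms(3) by (simp add: norm_barnes_integrand B_def)
  qed
qed

section \<open>Residues of the integrand and their sum\<close>

text \<open>
The residue of \<open>barnes_integrand I \<alpha> z\<close> at the pole \<open>- \<alpha>\<^sub>i - n\<close>, with all factors
\<open>\<Gamma>(\<alpha>\<^sub>j - \<alpha>\<^sub>i - n)\<close> rewritten by the functional equation so that the sum over \<open>n\<close> is a
hypergeometric series. The signs, one from the residue of Gamma and one from each of the other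
\<open>m - 1\<close> factors, combine to \<open>(-1)\<^sup>m\<^sup>n\<close>.
\<close>

definition slater_series_coeff :: "'i set \<Rightarrow> ('i \<Rightarrow> real) \<Rightarrow> real \<Rightarrow> 'i \<Rightarrow> nat \<Rightarrow> real" where
  "slater_series_coeff I \<alpha> z i n = z powr \<alpha> i * (\<Prod>j\<in>I - {i}. Gamma (\<alpha> j - \<alpha> i)) *
     (((-1) ^ card I * z) ^ n / (fact n * (\<Prod>j\<in>I - {i}. pochhammer (1 + \<alpha> i - \<alpha> j) n)))"

lemma Gamma_minus_nat:
  fixes b :: "'a :: Gamma"
  assumes "b \<notin> \<int>"
  shows "Gamma (b - of_nat n) = Gamma b * ((-1) ^ n / pochhammer (1 - b) n)"
proof -
  have "b - of_nat n \<notin> \<int>\<^sub>\<le>\<^sub>0"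
    using assms by (metis Ints_of_nat Ints_add diff_add_cancel nonpos_Ints_Int)
  moreover have "pochhammer (b - of_nat n) n = (-1) ^ n * pochhammer (1 - b) n"
    using pochhammer_minus[of "b - 1" n] by (simp add: power_mult_distrib[symmetric] flip: mult.assoc)
  ultimately show ?thesis
    by (cases "even n") (simp_all add: Gamma_shift_nat[of "b - of_nat n" n])
qed

text \<open>
Since \<open>\<alpha>\<^sub>j - \<alpha>\<^sub>i\<close> is never an integer, only the factor with index \<open>i\<close> is singular at \<open>- \<alpha>\<^sub>i - n\<close>; its
pole is simple, and the remaining factors are evaluated at the pole.
\<close>

lemma barnes_integrand_residue:
  assumes "finite I" "i \<in> I" "z > 0" and "\<And>j. j \<in> I \<Longrightarrow> j \<noteq> i \<Longrightarrow> \<alpha> j - \<alpha> i \<notin> \<int>"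
  shows "residue (barnes_integrand I \<alpha> z) (- of_real (\<alpha> i) - of_nat n) =
           of_real (slater_series_coeff I \<alpha> z i n)"
proof -
  define p where "p = - complex_of_real (\<alpha> i) - of_nat n"
  \<comment> \<open>The plane without all poles other than \<open>p\<close>.\<close>
  define S where "S = - (\<Union>j\<in>I. (\<lambda>w. of_real (\<alpha> j) + w) -` (\<int>\<^sub>\<le>\<^sub>0 - {of_real (\<alpha> j) + p}))"
  have other: "of_real (\<alpha> j) + p \<notin> \<int>\<^sub>\<le>\<^sub>0" if "j \<in> I - {i}" for j
  proof
    assume "of_real (\<alpha> j) + p \<in> \<int>\<^sub>\<le>\<^sub>0"
    also have "of_real (\<alpha> j) + p = complex_of_real (\<alpha> j - \<alpha> i - real n)"
      by (simp add: p_def)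
    finally have "\<alpha> j - \<alpha> i - real n \<in> \<int>"
      by (simp only: of_real_in_nonpos_Ints_iff nonpos_Ints_Int)
    hence "\<alpha> j - \<alpha> i \<in> \<int>" by simp
    with assms(4)[of j] that show False by auto
  qed
  define h :: "complex \<Rightarrow> complex" where "h = (\<lambda>w. (\<Prod>j\<in>I - {i}. Gamma (of_real (\<alpha> j) + w)) * of_real z powr (- w))"
  have split: "barnes_integrand I \<alpha> z w = Gamma (of_real (\<alpha> i) + w) * h w" for w
    using assms(1,2) by (simp add: barnes_integrand_def h_def prod.remove mult_ac)
  have "residue (barnes_integrand I \<alpha> z) p = (-1) ^ n / fact n * h p"
  proof (rule residue_simple')
    show "open S"
      unfolding S_def using assms(1)
      by (intro open_Compl closed_UN ballI continuous_closed_vimage closed_subset_Ints) (auto intro!: continuous_intros)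
    show "p \<in> S" by (auto simp: S_def)
    show "barnes_integrand I \<alpha> z holomorphic_on S - {p}"
      unfolding barnes_integrand_def using assms(3)
      by (intro holomorphic_intros holomorphic_Gamma') (auto simp: S_def)
    have "((\<lambda>w. (Gamma (of_real (\<alpha> i) + w) * ((of_real (\<alpha> i) + w) + of_nat n)) * h w)
             \<longlongrightarrow> (-1) ^ n / fact n * h p) (at p)"
    proof (rule tendsto_mult)
      have "filterlim (\<lambda>w. of_real (\<alpha> i) + w) (at (- of_nat n)) (at p)"
      proof (rule filterlim_atI)
        have "((\<lambda>w. of_real (\<alpha> i) + w) \<longlongrightarrow> of_real (\<alpha> i) + p) (at p)"
          by (intro tendsto_intros)
        thus "((\<lambda>w. of_real (\<alpha> i) + w) \<longlongrightarrow> - of_nat n) (at p)" by (simp add: p_def)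
        have "of_real (\<alpha> i) + w \<noteq> - of_nat n" if "w \<noteq> p" for w
          using that unfolding p_def by algebra
        thus "eventually (\<lambda>w. of_real (\<alpha> i) + w \<noteq> - of_nat n) (at p)"
          by (simp add: eventually_at_filter)
      qed
      from filterlim_compose[OF Gamma_residues this]
      show "((\<lambda>w. Gamma (of_real (\<alpha> i) + w) * ((of_real (\<alpha> i) + w) + of_nat n))
              \<longlongrightarrow> (-1) ^ n / fact n) (at p)" .
      show "(h \<longlongrightarrow> h p) (at p)"
        unfolding h_def using other assms(3)
        by (intro tendsto_intros) auto
    qed
    thus "((\<lambda>w. barnes_integrand I \<alpha> z w * (w - p)) \<longlongrightarrow> (-1) ^ n / fact n * h p) (at p)"
      by (simp add: split p_def algebra_simps)
  qed
  also have "h p = of_real ((\<Prod>j\<in>I - {i}. Gamma (\<alpha> j - \<alpha> i - real n)) * z powr (\<alpha> i + real n))"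
  proof -
    have "Gamma (of_real (\<alpha> j) + p) = of_real (Gamma (\<alpha> j - \<alpha> i - real n))" for j
      by (simp add: p_def algebra_simps flip: Gamma_complex_of_real)
    moreover have "complex_of_real z powr (- p) = of_real (z powr (\<alpha> i + real n))"
      using assms(3) powr_of_real[of z "\<alpha> i + real n"] by (simp add: p_def add.commute)
    ultimately show ?thesis by (simp add: h_def)
  qed
  also have "(\<Prod>j\<in>I - {i}. Gamma (\<alpha> j - \<alpha> i - real n)) =
             (\<Prod>j\<in>I - {i}. Gamma (\<alpha> j - \<alpha> i) * ((-1) ^ n / pochhammer (1 + \<alpha> i - \<alpha> j) n))"
  proof (intro prod.cong refl)
    fix j assume "j \<in> I - {i}"
    hence "\<alpha> j - \<alpha> i \<notin> \<int>" using assms(4) by auto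
    moreover have "1 - (\<alpha> j - \<alpha> i) = 1 + \<alpha> i - \<alpha> j" by simp
    ultimately show "Gamma (\<alpha> j - \<alpha> i - real n) =
        Gamma (\<alpha> j - \<alpha> i) * ((-1) ^ n / pochhammer (1 + \<alpha> i - \<alpha> j) n)"
      using Gamma_minus_nat[of "\<alpha> j - \<alpha> i" n] by metis
  qed
  also have "\<dots> = (\<Prod>j\<in>I - {i}. Gamma (\<alpha> j - \<alpha> i)) *
               (((-1) ^ n) ^ (card I - 1) / (\<Prod>j\<in>I - {i}. pochhammer (1 + \<alpha> i - \<alpha> j) n))"
    using assms(1,2) by (simp add: prod.distrib prod_dividef card_Diff_singleton)
  also have "z powr (\<alpha> i + real n) = z powr \<alpha> i * z ^ n"
    using assms(3) by (simp add: powr_add powr_realpow)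
  also have "(-1) ^ n / fact n * complex_of_real (
      (\<Prod>j\<in>I - {i}. Gamma (\<alpha> j - \<alpha> i)) *
      (((-1) ^ n) ^ (card I - 1) / (\<Prod>j\<in>I - {i}. pochhammer (1 + \<alpha> i - \<alpha> j) n)) * (z powr \<alpha> i * z ^ n))
      = of_real (z powr \<alpha> i * (\<Prod>j\<in>I - {i}. Gamma (\<alpha> j - \<alpha> i)) *
         (((-1) ^ n * ((-1) ^ n) ^ (card I - 1)) * z ^ n /
          (fact n * (\<Prod>j\<in>I - {i}. pochhammer (1 + \<alpha> i - \<alpha> j) n))))"
    by simp
  also have "(-1) ^ n * ((-1) ^ n) ^ (card I - 1) = (((-1) ^ card I) ^ n :: real)"
  proof -
    have "(-1) ^ n * ((-1) ^ n) ^ (card I - 1) = (((-1) ^ n) ^ card I :: real)"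
      using assms(1,2) by (cases "card I") auto
    also have "\<dots> = ((-1) ^ card I) ^ n"
      by (metis power_mult mult.commute)
    finally show ?thesis .
  qed
  also have "((-1) ^ card I) ^ n * z ^ n = ((-1) ^ card I * z) ^ n"
    by (simp add: power_mult_distrib)
  finally show ?thesis
    by (simp only: p_def slater_series_coeff_def)
qed

text \<open>
The reciprocal Pochhammer symbols are bounded, so the exponential series is a majorant.
\<close>

lemma summable_slater_series:
  assumes "\<And>j. j \<in> I \<Longrightarrow> j \<noteq> i \<Longrightarrow> \<alpha> j - \<alpha> i \<notin> \<int>"
  shows "summable (slater_series_coeff I \<alpha> z i)"
proof -
  let ?x = "(-1) ^ card I * z"
  let ?Q = "\<lambda>n. \<Prod>j\<in>I - {i}. 1 ^ n / pochhammer (1 + \<alpha> i - \<alpha> j) n"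
  have nonint: "1 + \<alpha> i - \<alpha> j \<notin> \<int>\<^sub>\<le>\<^sub>0" if "j \<in> I - {i}" for j
  proof
    assume "1 + \<alpha> i - \<alpha> j \<in> \<int>\<^sub>\<le>\<^sub>0"
    hence "1 - (1 + \<alpha> i - \<alpha> j) \<in> \<int>" by (intro Ints_diff Ints_1 nonpos_Ints_Int)
    with assms[of j] that show False by simp
  qed
  have "?Q \<longlonglongrightarrow> (\<Prod>j\<in>I - {i}. 0)"
    using nonint by (intro tendsto_prod power_over_pochhammer_tendsto_0)
  hence "Bseq ?Q" by (intro convergent_imp_Bseq convergentI)
  then obtain D where D: "\<And>n. norm (?Q n) \<le> D" by (auto simp: Bseq_def)
  have "summable (\<lambda>n. ?x ^ n / fact n * ?Q n)"
  proof (rule summable_comparison_test')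
    show "summable (\<lambda>n. D * (inverse (fact n) * \<bar>?x\<bar> ^ n))"
      by (intro summable_mult summable_exp)
    show "norm (?x ^ n / fact n * ?Q n) \<le> D * (inverse (fact n) * \<bar>?x\<bar> ^ n)" for n
    proof -
      have "norm (?x ^ n / fact n * ?Q n) = (inverse (fact n) * \<bar>?x\<bar> ^ n) * norm (?Q n)"
        by (simp add: norm_mult abs_mult power_abs divide_inverse power_mult_distrib)
      also have "\<dots> \<le> (inverse (fact n) * \<bar>?x\<bar> ^ n) * D"
        by (intro mult_left_mono D) auto
      finally show ?thesis by (simp only: mult.commute)
    qed
  qed
  hence "summable (\<lambda>n. z powr \<alpha> i * (\<Prod>j\<in>I - {i}. Gamma (\<alpha> j - \<alpha> i)) * (?x ^ n / fact n * ?Q n))"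
    by (rule summable_mult)
  thus ?thesis
    unfolding slater_series_coeff_def by (simp add: prod_dividef mult_ac)
qed

lemma vline_integrable_barnes_integrand:
  assumes "finite I" "I \<noteq> {}" "z > 0" and "\<And>i. i \<in> I \<Longrightarrow> \<alpha> i + x \<notin> \<int>\<^sub>\<le>\<^sub>0"
  shows "vline_integrable x (barnes_integrand I \<alpha> z)"
  unfolding vline_integrable_def
  by (intro integrable_mult_left barnes_integrand_vertical_integrable assms)

lemma norm_barnes_integrand_shift_left_le:
  assumes "z > 0" "\<And>i. i \<in> I \<Longrightarrow> \<alpha> i + c \<notin> \<int>"
  shows "norm (barnes_integrand I \<alpha> z (Complex (c - real n) t)) \<le>
     (z ^ n * (\<Prod>i\<in>I. 1 / \<bar>pochhammer (1 - (\<alpha> i + c)) n\<bar>)) * norm (barnes_integrand I \<alpha> z (Complex c t))"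
proof -
  have "(\<Prod>i\<in>I. norm (Gamma (Complex (\<alpha> i + (c - real n)) t))) \<le>
        (\<Prod>i\<in>I. norm (Gamma (Complex (\<alpha> i + c) t)) * (1 / \<bar>pochhammer (1 - (\<alpha> i + c)) n\<bar>))"
    using norm_Gamma_shift_left_le[OF assms(2), of _ n t]
    by (intro prod_mono) (auto simp: algebra_simps)
  hence "norm (barnes_integrand I \<alpha> z (Complex (c - real n) t)) \<le>
      (\<Prod>i\<in>I. norm (Gamma (Complex (\<alpha> i + c) t)) * (1 / \<bar>pochhammer (1 - (\<alpha> i + c)) n\<bar>)) *
        z powr (- (c - real n))"
    unfolding norm_barnes_integrand[OF assms(1)] by (rule mult_right_mono) auto
  also have "z powr (- (c - real n)) = z ^ n * z powr (- c)"
    using assms(1) by (simp add: powr_diff powr_realpow powr_minus field_simps)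
  finally show ?thesis
    unfolding norm_barnes_integrand[OF assms(1)] prod.distrib by (simp only: mult_ac)
qed

text \<open>
Shifting the line by \<open>n\<close> multiplies the \<open>L\<^sup>1\<close> norm of the integrand by at most
\<open>D n = z\<^sup>n / \<Prod>\<^sub>i \<bar>pochhammer (1 - \<alpha>\<^sub>i - c) n\<bar>\<close>, which tends to 0.
\<close>

lemma barnes_vline_integral_shift_left_tendsto_0:
  assumes "finite I" "I \<noteq> {}" "z > 0" and c: "\<And>i. i \<in> I \<Longrightarrow> \<alpha> i + c \<notin> \<int>"
  shows "(\<lambda>n. vline_integral (c - real n) (barnes_integrand I \<alpha> z)) \<longlonglongrightarrow> 0"
proof -
  let ?g = "barnes_integrand I \<alpha> z"
  define J where "J = (LINT t|lborel. norm (?g (Complex c t)))"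
  define D where "D = (\<lambda>n. z ^ n * (\<Prod>i\<in>I. 1 / \<bar>pochhammer (1 - (\<alpha> i + c)) n\<bar>))"
  \<comment> \<open>Distributing \<open>z\<^sup>n\<close> evenly over the factors makes \<open>D n\<close> a product of null sequences.\<close>
  define y where "y = z powr (1 / card I)"
  have y: "y ^ card I = z" "y > 0"
    using assms(1-3) by (simp_all add: y_def powr_power card_gt_0_iff)
  have D_eq: "D n = (\<Prod>i\<in>I. \<bar>y ^ n / pochhammer (1 - (\<alpha> i + c)) n\<bar>)" for n
  proof -
    have "z ^ n = (y ^ n) ^ card I"
      by (metis y(1) power_mult mult.commute)
    thus ?thesis using y(2) by (simp add: D_def prod_dividef abs_divide)
  qed
  have nonint: "1 - (\<alpha> i + c) \<notin> \<int>\<^sub>\<le>\<^sub>0" if "i \<in> I" for i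
  proof
    assume "1 - (\<alpha> i + c) \<in> \<int>\<^sub>\<le>\<^sub>0"
    hence "1 - (1 - (\<alpha> i + c)) \<in> \<int>" by (intro Ints_diff Ints_1 nonpos_Ints_Int)
    with c[OF that] show False by simp
  qed
  have "D \<longlonglongrightarrow> (\<Prod>i\<in>I. 0)"
    unfolding D_eq using nonint
    by (intro tendsto_prod tendsto_rabs_zero power_over_pochhammer_tendsto_0)
  hence "D \<longlonglongrightarrow> 0"
    using assms(1,2) by (simp add: power_0_left)
  hence lim: "(\<lambda>n. D n * J) \<longlonglongrightarrow> 0"
    by (rule tendsto_mult_left_zero)
  show ?thesis
  proof (rule Lim_null_comparison[OF _ lim], rule always_eventually, rule allI)
    fix n
    have nonint': "\<alpha> i + (c - real n) \<notin> \<int>\<^sub>\<le>\<^sub>0" if "i \<in> I" for i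
    proof
      assume "\<alpha> i + (c - real n) \<in> \<int>\<^sub>\<le>\<^sub>0"
      hence "\<alpha> i + (c - real n) + real n \<in> \<int>" by (intro Ints_add Ints_of_nat nonpos_Ints_Int)
      with c[OF that] show False by simp
    qed
    have "norm (vline_integral (c - real n) ?g) \<le> (LINT t|lborel. norm (?g (Complex (c - real n) t) * \<i>))"
      unfolding vline_integral_def by (rule integral_norm_bound)
    also have "\<dots> \<le> (LINT t|lborel. D n * norm (?g (Complex c t)))"
      using norm_barnes_integrand_shift_left_le[OF assms(3) c] nonint' c
      by (intro integral_mono integrable_mult_right integrable_norm integrable_mult_left
            barnes_integrand_vertical_integrable assms(1-3)) (auto simp: norm_mult D_def dest: nonpos_Ints_Int)
    also have "\<dots> = D n * J" by (simp add: J_def)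
    finally show "norm (vline_integral (c - real n) ?g) \<le> D n * J" .
  qed
qed

text \<open>
Supplies a line \<open>Re s = c\<close> such that no line \<open>Re s = c - n\<close> meets a pole of the integrand. Only
countably many abscissae are excluded.
\<close>

lemma ex_real_below_avoiding_Ints_shifts:
  assumes "finite I"
  obtains c :: real where "c < k" "\<And>i. i \<in> I \<Longrightarrow> \<alpha> i + c \<notin> \<int>"
proof -
  have "countable (\<Union>i\<in>I. (\<lambda>m. of_int m - \<alpha> i) ` UNIV)"
    using assms by (intro countable_UN countable_finite[OF assms] countable_image) auto
  moreover have "uncountable {k - 1<..<k}"
    by (simp add: uncountable_open_interval)
  ultimately obtain c where "c \<in> {k - 1<..<k}" "c \<notin> (\<Union>i\<in>I. (\<lambda>m. of_int m - \<alpha> i) ` UNIV)"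
    by (metis countable_subset subsetI)
  thus ?thesis
    by (intro that[of c]) (auto elim!: Ints_cases simp: algebra_simps image_iff)
qed

text \<open>
Slater's theorem for \<open>G\<^sup>m\<^sup>,\<^sup>0\<^sub>0\<^sub>,\<^sub>m\<close>. The line \<open>Re s = k\<close>, to the right of all poles, is moved to
\<open>Re s = c\<^sub>0 - n\<close>. This picks up the residues at the finitely many poles in between, and the
remaining integral tends to 0.
\<close>

theorem barnes_vline_integral_eq_slater_series:
  assumes "finite I" "I \<noteq> {}" "z > 0"
    and nonint: "\<And>i j. i \<in> I \<Longrightarrow> j \<in> I \<Longrightarrow> j \<noteq> i \<Longrightarrow> \<alpha> j - \<alpha> i \<notin> \<int>"
    and k: "\<And>i. i \<in> I \<Longrightarrow> - \<alpha> i < k"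
  shows "1 / (2 * of_real pi * \<i>) * vline_integral k (barnes_integrand I \<alpha> z) =
           of_real (\<Sum>i\<in>I. \<Sum>n. slater_series_coeff I \<alpha> z i n)"
proof -
  let ?g = "barnes_integrand I \<alpha> z" and ?T = "slater_series_coeff I \<alpha> z"
  obtain c0 where c0: "c0 < k" "\<And>i. i \<in> I \<Longrightarrow> \<alpha> i + c0 \<notin> \<int>"
    using ex_real_below_avoiding_Ints_shifts[OF assms(1)] by blast
  define c where "c = (\<lambda>n. c0 - real n)"
  \<comment> \<open>The number of poles \<open>- \<alpha>\<^sub>i - l\<close> to the right of the line \<open>Re s = c n\<close>.\<close>
  define M where "M = (\<lambda>n i. nat \<lceil>real n - (\<alpha> i + c0)\<rceil>)"
  define pole where "pole = (\<lambda>i l. - complex_of_real (\<alpha> i) - of_nat l)"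
  have Re_pole: "c n < Re (pole i l) \<longleftrightarrow> l < M n i" for n i l
    unfolding c_def pole_def M_def by (simp, linarith)
  have c_notin: "\<alpha> i + c n \<notin> \<int>" if "i \<in> I" for i n
    using c0(2)[OF that] Ints_add[of "\<alpha> i + c n" "real n"] by (auto simp: c_def)
  have inj: "inj_on (\<lambda>(i, l). pole i l) (SIGMA i:I. A i)" for A
  proof (rule inj_onI, clarify)
    fix i l j m
    assume ij: "i \<in> I" "j \<in> I" and eq: "pole i l = pole j m"
    hence "complex_of_real (\<alpha> i + real l) = of_real (\<alpha> j + real m)"
      by (simp add: pole_def algebra_simps)
    hence *: "\<alpha> i + real l = \<alpha> j + real m"
      by (simp only: of_real_eq_iff)
    hence "\<alpha> j - \<alpha> i = of_int (int l - int m)" by simp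
    hence "\<alpha> j - \<alpha> i \<in> \<int>" by (metis Ints_of_int)
    with nonint[OF ij] have "j = i" by blast
    with * show "i = j \<and> l = m" by simp
  qed
  have shift: "1 / (2 * of_real pi * \<i>) * (vline_integral k ?g - vline_integral (c n) ?g) =
      of_real (\<Sum>i\<in>I. \<Sum>l<M n i. ?T i l)" for n
  proof -
    \<comment> \<open>The poles to the right of \<open>Re s = c (n + 1)\<close>: a half-plane containing the closed strip.\<close>
    define P where "P = (\<lambda>(i, l). pole i l) ` (SIGMA i:I. {..<M (Suc n) i})"
    obtain B where B: "(B \<longlongrightarrow> 0) at_top"
      "\<And>\<sigma> t. c n \<le> \<sigma> \<Longrightarrow> \<sigma> \<le> k \<Longrightarrow> \<bar>t\<bar> \<ge> 1 \<Longrightarrow> norm (?g (Complex \<sigma> t)) \<le> B \<bar>t\<bar>"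
      using barnes_integrand_strip_decay[OF assms(1-3)] by metis
    have "vline_integral k ?g - vline_integral (c n) ?g =
            2 * pi * \<i> * (\<Sum>p | p \<in> P \<and> c n < Re p. residue ?g p)"
    proof (rule vline_integral_shift[where B = B])
      show "(B \<longlongrightarrow> 0) at_top" by (rule B(1))
      show "norm (?g (Complex \<sigma> t)) \<le> B \<bar>t\<bar>" if "c n \<le> \<sigma>" "\<sigma> \<le> k" "\<bar>t\<bar> \<ge> 1" for \<sigma> t
        using that by (rule B(2))
      show "c (Suc n) < c n" "c n < k"
        using c0(1) by (auto simp: c_def)
      show "finite P" unfolding P_def using assms(1) by auto
      show "Re p \<noteq> c n" "Re p < k" if p: "p \<in> P" for p
      proof -
        obtain i l where il: "i \<in> I" "p = pole i l" using p by (auto simp: P_def)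
        show "Re p < k" using k[OF il(1)] il by (simp add: pole_def)
        show "Re p \<noteq> c n"
        proof
          assume "Re p = c n"
          hence "\<alpha> i + c n = of_int (- int l)" using il by (simp add: pole_def)
          with c_notin[OF il(1), of n] show False by (metis Ints_of_int)
        qed
      qed
      show "?g holomorphic_on {s. c (Suc n) < Re s} - P"
        unfolding barnes_integrand_def
      proof (intro holomorphic_intros holomorphic_Gamma')
        fix i s assume i: "i \<in> I" and s: "s \<in> {s. c (Suc n) < Re s} - P"
        show "of_real (\<alpha> i) + s \<notin> \<int>\<^sub>\<le>\<^sub>0"
        proof
          assume "of_real (\<alpha> i) + s \<in> \<int>\<^sub>\<le>\<^sub>0"
          then obtain l where "of_real (\<alpha> i) + s = - of_nat l" by (auto elim!: nonpos_Ints_cases')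
          hence sl: "s = pole i l" unfolding pole_def by algebra
          hence "l < M (Suc n) i" using s by (simp add: Re_pole)
          hence "s \<in> P" using sl i by (force simp: P_def)
          with s show False by blast
        qed
      qed
      have "\<alpha> i + c n \<notin> \<int>\<^sub>\<le>\<^sub>0" "\<alpha> i + k \<notin> \<int>\<^sub>\<le>\<^sub>0" if "i \<in> I" for i
        using c_notin[OF that, of n] k[OF that] by (auto dest: nonpos_Ints_Int elim!: nonpos_Ints_cases')
      thus "vline_integrable (c n) ?g" "vline_integrable k ?g"
        by (auto intro!: vline_integrable_barnes_integrand assms(1-3))
    qed
    also have "{p. p \<in> P \<and> c n < Re p} = (\<lambda>(i, l). pole i l) ` (SIGMA i:I. {..<M n i})"
    proof -
      have "M n i \<le> M (Suc n) i" for i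
        unfolding M_def by (intro nat_mono ceiling_mono) auto
      hence "{x \<in> (SIGMA i:I. {..<M (Suc n) i}). c n < Re (case_prod pole x)} = (SIGMA i:I. {..<M n i})"
        by (auto simp: Re_pole intro: less_le_trans)
      thus ?thesis
        unfolding P_def by blast
    qed
    also have "(\<Sum>p\<in>\<dots>. residue ?g p) = (\<Sum>(i, l)\<in>(SIGMA i:I. {..<M n i}). residue ?g (pole i l))"
      by (subst sum.reindex[OF inj]) (simp add: case_prod_unfold)
    also have "\<dots> = (\<Sum>i\<in>I. \<Sum>l<M n i. residue ?g (pole i l))"
      using assms(1) by (subst sum.Sigma) auto
    also have "\<dots> = (\<Sum>i\<in>I. \<Sum>l<M n i. of_real (?T i l))"
      unfolding pole_def using assms(1,3) nonint
      by (intro sum.cong refl barnes_integrand_residue) auto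
    finally show ?thesis by (simp add: field_simps)
  qed
  have "(\<lambda>n. of_real (\<Sum>i\<in>I. \<Sum>l<M n i. ?T i l) :: complex) \<longlonglongrightarrow> of_real (\<Sum>i\<in>I. suminf (?T i))"
  proof (intro tendsto_of_real tendsto_sum)
    fix i assume i: "i \<in> I"
    have "?T i sums suminf (?T i)"
      using nonint[OF i] by (intro summable_sums summable_slater_series) auto
    moreover have "filterlim (\<lambda>n. M n i) at_top sequentially"
      unfolding filterlim_at_top
    proof
      fix Z
      show "eventually (\<lambda>n. Z \<le> M n i) sequentially"
        using eventually_ge_at_top[of "nat \<lceil>real Z + (\<alpha> i + c0)\<rceil>"]
        by eventually_elim (unfold M_def, linarith)
    qed
    ultimately show "(\<lambda>n. \<Sum>l<M n i. ?T i l) \<longlonglongrightarrow> suminf (?T i)"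
      unfolding sums_def by (rule filterlim_compose)
  qed
  moreover have "(\<lambda>n. 1 / (2 * of_real pi * \<i>) * (vline_integral k ?g - vline_integral (c n) ?g))
      \<longlonglongrightarrow> 1 / (2 * of_real pi * \<i>) * (vline_integral k ?g - 0)"
    unfolding c_def using c0(2)
    by (intro tendsto_mult_left tendsto_diff tendsto_const
          barnes_vline_integral_shift_left_tendsto_0 assms(1-3))
  ultimately show ?thesis
    unfolding shift using LIMSEQ_unique by fastforce
qed

section \<open>One Gamma factor: the exponential function\<close>

text \<open>
Slater's theorem for a single parameter: no other Gamma factor remains in the residues, so they
are \<open>z\<^sup>a (-z)\<^sup>n / n!\<close>. The factor \<open>\<i>\<close> from \<open>ds = \<i> dt\<close> cancels, which leaves \<open>2 * pi\<close>.
\<close>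

lemma Cahen_Mellin:
  assumes "z > 0" "- a < k"
  shows "integrable lborel (\<lambda>t. Gamma (Complex (a + k) t) * of_real z powr (- Complex k t))"
    and "(LINT t|lborel. Gamma (Complex (a + k) t) * of_real z powr (- Complex k t)) =
           of_real (2 * pi * (z powr a * exp (- z)))"
proof -
  let ?I = "{()}" and ?\<alpha> = "\<lambda>_::unit. a"
  have eq: "barnes_integrand ?I ?\<alpha> z (Complex k t) =
      Gamma (Complex (a + k) t) * of_real z powr (- Complex k t)" for t
    by (simp add: barnes_integrand_def of_real_plus_Complex)
  have "a + k \<notin> \<int>\<^sub>\<le>\<^sub>0" using assms(2) by (auto elim!: nonpos_Ints_cases')
  thus "integrable lborel (\<lambda>t. Gamma (Complex (a + k) t) * of_real z powr (- Complex k t))"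
    using barnes_integrand_vertical_integrable[of ?I z ?\<alpha> k] assms(1) by (simp add: eq)
  have "(\<lambda>n. z powr a * ((- z) ^ n / fact n)) sums (z powr a * exp (- z))"
    using exp_converges[of "- z"] by (intro sums_mult) (simp add: divide_inverse mult.commute)
  hence "suminf (slater_series_coeff ?I ?\<alpha> z ()) = z powr a * exp (- z)"
    by (simp add: sums_iff slater_series_coeff_def[abs_def])
  hence "1 / (2 * of_real pi * \<i>) * vline_integral k (barnes_integrand ?I ?\<alpha> z) =
           of_real (z powr a * exp (- z))"
    using barnes_vline_integral_eq_slater_series[of ?I z ?\<alpha> k] assms by simp
  thus "(LINT t|lborel. Gamma (Complex (a + k) t) * of_real z powr (- Complex k t)) =
           of_real (2 * pi * (z powr a * exp (- z)))"
    by (simp add: vline_integral_def eq field_simps)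
qed

section \<open>Two Gamma factors: the hypergeometric form\<close>

lemma meijer_G2002_integrand_conv_barnes:
  "meijer_G2002_integrand \<alpha>1 \<alpha>2 z = barnes_integrand UNIV (\<lambda>b. if b then \<alpha>1 else \<alpha>2) z"
  by (simp add: fun_eq_iff meijer_G2002_integrand_def barnes_integrand_def UNIV_bool mult_ac)

lemma vline_integrable_meijer_G2002_integrand:
  assumes "z > 0" "- \<alpha>1 < k" "- \<alpha>2 < k"
  shows "vline_integrable k (meijer_G2002_integrand \<alpha>1 \<alpha>2 z)"
  unfolding meijer_G2002_integrand_conv_barnes using assms
  by (intro vline_integrable_barnes_integrand) (auto elim!: nonpos_Ints_cases')

text \<open>
The two residue series, one for each parameter. The truth values index the parameters, so the
index opposite to \<open>i\<close> is \<open>\<not> i\<close>; for \<open>m = 2\<close> the signs \<open>(-1)\<^sup>m\<^sup>n\<close> are trivial.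
\<close>

lemma meijer_G2002_eq_0F1:
  assumes "z > 0" "- \<alpha>1 < k" "- \<alpha>2 < k" and nonint: "\<alpha>1 - \<alpha>2 \<notin> \<int>"
  shows "meijer_G2002 k \<alpha>1 \<alpha>2 z = of_real
    (z powr \<alpha>1 * Gamma (\<alpha>2 - \<alpha>1) * hypergeo_0F1 (1 + \<alpha>1 - \<alpha>2) z +
     z powr \<alpha>2 * Gamma (\<alpha>1 - \<alpha>2) * hypergeo_0F1 (1 + \<alpha>2 - \<alpha>1) z)"
proof -
  let ?\<alpha> = "\<lambda>b. if b then \<alpha>1 else \<alpha>2"
  let ?T = "slater_series_coeff UNIV ?\<alpha> z"
  have nonint': "\<alpha>2 - \<alpha>1 \<notin> \<int>"
    using Ints_minus[of "\<alpha>2 - \<alpha>1"] nonint by auto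
  have sub: "UNIV - {True} = {False}" "UNIV - {False} = {True}"
    by auto
  have ne: "?\<alpha> j - ?\<alpha> i \<notin> \<int>" if "j \<noteq> i" for i j
    using that nonint nonint' by (cases i; cases j) auto
  have val: "suminf (?T i) = z powr ?\<alpha> i * Gamma (?\<alpha> (\<not> i) - ?\<alpha> i) * hypergeo_0F1 (1 + ?\<alpha> i - ?\<alpha> (\<not> i)) z" for i
  proof -
    let ?c = "z powr ?\<alpha> i * Gamma (?\<alpha> (\<not> i) - ?\<alpha> i)"
    have eq: "?T i = (\<lambda>n. ?c * (z ^ n / (pochhammer (1 + ?\<alpha> i - ?\<alpha> (\<not> i)) n * fact n)))"
      by (cases i) (auto simp: slater_series_coeff_def fun_eq_iff sub mult_ac)
    have "?c \<noteq> 0"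
      using assms(1) nonint nonint' by (cases i) (auto simp: Gamma_eq_zero_iff dest: nonpos_Ints_Int)
    moreover have "summable (?T i)"
      using ne by (intro summable_slater_series) auto
    ultimately have "summable (\<lambda>n. z ^ n / (pochhammer (1 + ?\<alpha> i - ?\<alpha> (\<not> i)) n * fact n))"
      unfolding eq by (simp only: summable_cmult_iff) simp
    thus ?thesis
      unfolding eq hypergeo_0F1_def by (rule suminf_mult)
  qed
  have "meijer_G2002 k \<alpha>1 \<alpha>2 z = of_real (\<Sum>i\<in>UNIV. suminf (?T i))"
    unfolding meijer_G2002_def meijer_G2002_integrand_conv_barnes
    using assms(1-3) ne by (intro barnes_vline_integral_eq_slater_series) auto
  thus ?thesis
    unfolding val by (simp add: UNIV_bool add.commute)
qed

section \<open>The integral representations\<close>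

text \<open>
Euler's integral with respect to Lebesgue-Borel measure. The power \<open>y powr (s - 1)\<close> is written with the
exponential function, which makes it jointly measurable in \<open>y\<close> and \<open>s\<close>.
\<close>

lemma Gamma_lebesgue_integral:
  assumes "Re s > 0"
  shows "set_integrable lborel {0<..} (\<lambda>y. exp ((s - 1) * of_real (ln y)) * of_real (exp (- y)))"
    and "(LBINT y:{0<..}. exp ((s - 1) * of_real (ln y)) * of_real (exp (- y))) = Gamma s"
proof -
  let ?f = "\<lambda>y::real. exp ((s - 1) * of_real (ln y)) * of_real (exp (- y))"
  have eq: "of_real y powr (s - 1) / of_real (exp y) = ?f y" if "y \<in> {0<..}" for y :: real
    using that by (auto simp: powr_def Ln_of_real exp_minus divide_inverse)
  have "?f absolutely_integrable_on {0<..}"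
    using absolutely_integrable_Gamma_integral'[OF assms]
    by (rule set_integrable_cong[THEN iffD1, rotated -1]) (auto simp: eq)
  hence "integrable lebesgue (\<lambda>y. indicator {0<..} y *\<^sub>R ?f y)"
    by (simp add: set_integrable_def)
  moreover have "(\<lambda>y. indicator {0<..} y *\<^sub>R ?f y) \<in> borel_measurable lborel"
    by measurable
  ultimately show int: "set_integrable lborel {0<..} ?f"
    unfolding set_integrable_def by (simp add: integrable_completion)
  have "(?f has_integral Gamma s) {0<..}"
    using Gamma_integral_complex'[OF assms] by (rule has_integral_eq[rotated]) (rule eq)
  thus "(LBINT y:{0<..}. ?f y) = Gamma s"
    using set_borel_integral_eq_integral(2)[OF int] by (simp add: has_integral_iff)
qed

text \<open>
Fubini's theorem for \<open>\<Gamma>(\<alpha>\<^sub>1 + s) z\<^sup>-\<^sup>s\<close> times \<open>y powr (\<alpha>\<^sub>2 + s - 1) * exp (- y)\<close>, on the product of the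
line \<open>s = k + it\<close> and the half-line \<open>y > 0\<close>. Integrating over \<open>y\<close> yields the Meijer integrand; integrating over \<open>t\<close> yields, by
Cahen-Mellin at \<open>z / y\<close>, the integrand of the asserted representation, whose integrability is thus
part of Fubini's theorem. Absolute convergence holds because the modulus is a product of a
function of \<open>t\<close> and a function of \<open>y\<close>: \<open>\<bar>y\<^sup>s\<bar>\<close> does not depend on \<open>t\<close>.
\<close>

lemma meijer_G2002_eq_Laplace_type_integral:
  assumes "z > 0" "- \<alpha>1 < k" "- \<alpha>2 < k"
  shows "set_integrable lborel {0<..} (\<lambda>y. y powr (\<alpha>2 - \<alpha>1 - 1) * exp (- (z / y) - y))"
    and "meijer_G2002 k \<alpha>1 \<alpha>2 z = of_real (z powr \<alpha>1 *
           (LBINT y:{0<..}. y powr (\<alpha>2 - \<alpha>1 - 1) * exp (- (z / y) - y)))"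
proof -
  define A where "A = (\<lambda>t. Gamma (Complex (\<alpha>1 + k) t) * exp (- Complex k t * of_real (ln z)))"
  define E where "E = (\<lambda>t y. exp ((Complex (\<alpha>2 + k) t - 1) * of_real (ln y)) * of_real (exp (- y)) :: complex)"
  define H where "H = (\<lambda>t y. indicator {0<..} y *\<^sub>R (A t * E t y))"
  let ?R = "\<lambda>y. y powr (\<alpha>2 - \<alpha>1 - 1) * exp (- (z / y) - y)"
  have nonint: "\<alpha>1 + k \<notin> \<int>\<^sub>\<le>\<^sub>0"
    using assms(2) by (auto elim!: nonpos_Ints_cases')
  have A_powr: "A t = Gamma (Complex (\<alpha>1 + k) t) * of_real z powr (- Complex k t)" for t
    using assms(1) by (simp add: A_def powr_def Ln_of_real)
  have A_int: "integrable lborel A"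
    unfolding A_powr using Cahen_Mellin(1)[of z \<alpha>1 k] assms by simp
  have [measurable]: "A \<in> borel_measurable borel"
    using borel_measurable_integrable[OF A_int] by simp
  have [measurable]: "(\<lambda>t. Complex x t) \<in> borel_measurable borel" for x
    unfolding Complex_eq by measurable
  have meas: "case_prod H \<in> borel_measurable (lborel \<Otimes>\<^sub>M lborel)"
    unfolding H_def E_def by measurable
  have E_int: "set_integrable lborel {0<..} (E t)"
    and E_val: "(LBINT y:{0<..}. E t y) = Gamma (Complex (\<alpha>2 + k) t)" for t
    unfolding E_def using Gamma_lebesgue_integral[of "Complex (\<alpha>2 + k) t"] assms(3) by simp_all
  have norm_E: "norm (E t y) = norm (E 0 y)" for t y
    by (simp add: E_def norm_mult)
  have H_int: "integrable lborel (H t)" for t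
    using E_int[of t] unfolding H_def set_integrable_def
    by (subst mult_scaleR_right[symmetric]) (rule integrable_mult_right)
  have "integrable (lborel \<Otimes>\<^sub>M lborel) (case_prod H)"
  proof (rule lborel_pair.Fubini_integrable[OF meas])
    have "(LINT y|lborel. norm (H t y)) = norm (A t) * (LINT y|lborel. norm (indicator {0<..} y *\<^sub>R E 0 y))" for t
      by (simp add: H_def norm_mult norm_E[of t] mult_ac)
    thus "integrable lborel (\<lambda>t. LINT y|lborel. norm (case_prod H (t, y)))"
      using A_int by (simp add: integrable_norm)
    show "AE t in lborel. integrable lborel (\<lambda>y. case_prod H (t, y))"
      using H_int by simp
  qed
  note fub = lborel_pair.Fubini_integral[OF this] lborel_pair.integrable_snd[OF this]
  have in_y: "(LINT y|lborel. H t y) = A t * Gamma (Complex (\<alpha>2 + k) t)" for t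
  proof -
    have "(LINT y|lborel. H t y) = A t * (LINT y|lborel. indicator {0<..} y *\<^sub>R E t y)"
      by (simp add: H_def flip: mult_scaleR_right)
    thus ?thesis using E_val[of t] by (simp add: set_lebesgue_integral_def)
  qed
  have in_t: "(LINT t|lborel. H t y) = of_real (2 * pi * z powr \<alpha>1 * (indicator {0<..} y *\<^sub>R ?R y))" for y
  proof (cases "y > 0")
    case True
    have "H t y = of_real (y powr (\<alpha>2 - 1) * exp (- y)) *
            (Gamma (Complex (\<alpha>1 + k) t) * of_real (z / y) powr (- Complex k t))" for t
    proof -
      have "exp (- Complex k t * of_real (ln z)) * exp ((Complex (\<alpha>2 + k) t - 1) * of_real (ln y)) =
            of_real (exp ((\<alpha>2 - 1) * ln y)) * exp (- Complex k t * of_real (ln (z / y)))"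
      proof -
        have "- Complex k t * of_real (ln z) + (Complex (\<alpha>2 + k) t - 1) * of_real (ln y) =
              of_real ((\<alpha>2 - 1) * ln y) + - Complex k t * of_real (ln (z / y))"
          using assms(1) True by (simp add: ln_div complex_eq_iff algebra_simps)
        thus ?thesis by (simp only: exp_add[symmetric] exp_of_real[symmetric])
      qed
      moreover have "of_real (z / y) powr (- Complex k t) = exp (- Complex k t * of_real (ln (z / y)))"
        using True assms(1) Ln_of_real[of "z / y"] by (simp add: powr_def)
      ultimately show ?thesis
        using True by (simp add: H_def A_def E_def powr_def mult_ac)
    qed
    hence "(LINT t|lborel. H t y) = of_real (y powr (\<alpha>2 - 1) * exp (- y)) *
             of_real (2 * pi * ((z / y) powr \<alpha>1 * exp (- (z / y))))"
      using Cahen_Mellin(2)[of "z / y" \<alpha>1 k] True assms by simp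
    also have "(z / y) powr \<alpha>1 = z powr \<alpha>1 * y powr (- \<alpha>1)"
      using True assms(1) by (simp add: powr_divide powr_minus_divide)
    also have "of_real (y powr (\<alpha>2 - 1) * exp (- y)) *
             of_real (2 * pi * (z powr \<alpha>1 * y powr (- \<alpha>1) * exp (- (z / y)))) =
           complex_of_real (2 * pi * z powr \<alpha>1 * (y powr (\<alpha>2 - 1) * y powr (- \<alpha>1)) * (exp (- (z / y)) * exp (- y)))"
      by simp
    also have "y powr (\<alpha>2 - 1) * y powr (- \<alpha>1) = y powr (\<alpha>2 - \<alpha>1 - 1)"
      by (simp add: powr_add[symmetric] algebra_simps)
    also have "exp (- (z / y)) * exp (- y) = exp (- (z / y) - y)"
      by (simp add: exp_add[symmetric])
    finally show ?thesis using True by (simp add: mult_ac)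
  qed (simp add: H_def)
  have "integrable lborel (\<lambda>y. Re (LINT t|lborel. H t y))"
    using fub(2) by (rule integrable_Re)
  hence "integrable lborel (\<lambda>y. 2 * pi * z powr \<alpha>1 * (indicator {0<..} y *\<^sub>R ?R y))"
    unfolding in_t Re_complex_of_real .
  thus "set_integrable lborel {0<..} ?R"
    unfolding set_integrable_def integrable_mult_right_iff using assms(1) by auto
  have "(LINT t|lborel. A t * Gamma (Complex (\<alpha>2 + k) t)) =
        (LINT y|lborel. complex_of_real (2 * pi * z powr \<alpha>1 * (indicator {0<..} y *\<^sub>R ?R y)))"
    using fub(1) unfolding in_y in_t by simp
  also have "\<dots> = of_real (2 * pi * z powr \<alpha>1 * (LBINT y:{0<..}. ?R y))"
    unfolding integral_complex_of_real set_lebesgue_integral_def by simp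
  finally have eq: "(LINT t|lborel. A t * Gamma (Complex (\<alpha>2 + k) t)) = 
      of_real (2 * pi * z powr \<alpha>1 * (LBINT y:{0<..}. ?R y))" .
  have "vline_integral k (meijer_G2002_integrand \<alpha>1 \<alpha>2 z) = (LINT t|lborel. A t * Gamma (Complex (\<alpha>2 + k) t)) * \<i>"
    by (simp add: vline_integral_def meijer_G2002_integrand_def A_powr of_real_plus_Complex mult_ac)
  thus "meijer_G2002 k \<alpha>1 \<alpha>2 z = of_real (z powr \<alpha>1 * (LBINT y:{0<..}. ?R y))"
    unfolding eq by (simp add: meijer_G2002_def)
qed

lemma Laplace_type_integral_scale:
  fixes b w \<beta> :: real
  assumes "b > 0"
    and "set_integrable lborel {0<..} (\<lambda>y. y powr (\<beta> - 1) * exp (- (b * w / y) - y))"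
  shows "set_integrable lborel {0<..} (\<lambda>v. v powr (\<beta> - 1) * exp (- (w / v) - b * v))"
    and "(LBINT y:{0<..}. y powr (\<beta> - 1) * exp (- (b * w / y) - y)) =
           b powr \<beta> * (LBINT v:{0<..}. v powr (\<beta> - 1) * exp (- (w / v) - b * v))"
proof -
  let ?f = "\<lambda>y. indicator {0<..} y *\<^sub>R (y powr (\<beta> - 1) * exp (- (b * w / y) - y))"
  let ?g = "\<lambda>v. indicator {0<..} v *\<^sub>R (v powr (\<beta> - 1) * exp (- (w / v) - b * v))"
  have eq: "?f (0 + b * v) = b powr (\<beta> - 1) * ?g v" for v
    using assms(1) by (auto simp: indicator_def powr_mult zero_less_mult_iff)
  have "integrable lborel (\<lambda>v. ?f (0 + b * v))"
    using assms by (intro lborel_integrable_real_affine) (auto simp: set_integrable_def)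
  thus "set_integrable lborel {0<..} (\<lambda>v. v powr (\<beta> - 1) * exp (- (w / v) - b * v))"
    unfolding eq set_integrable_def integrable_mult_right_iff using assms(1) by auto
  have "(LINT y|lborel. ?f y) = \<bar>b\<bar> *\<^sub>R (LINT v|lborel. ?f (0 + b * v))"
    using assms(1) by (intro lborel_integral_real_affine) auto
  also have "\<dots> = b * b powr (\<beta> - 1) * (LINT v|lborel. ?g v)"
    unfolding eq using assms(1) by simp
  also have "b * b powr (\<beta> - 1) = b powr \<beta>"
    using assms(1) by (simp add: powr_mult_base)
  finally show "(LBINT y:{0<..}. y powr (\<beta> - 1) * exp (- (b * w / y) - y)) =
           b powr \<beta> * (LBINT v:{0<..}. v powr (\<beta> - 1) * exp (- (w / v) - b * v))"
    by (simp only: set_lebesgue_integral_def)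
qed

lemma meijer_G2002_eq_scaled_integral:
  assumes "a1 > 0" "a2 > 0" "u > 0" "- \<alpha>1 < k" "- \<alpha>2 < k"
  shows "set_integrable lborel {0<..} (\<lambda>v. v powr (\<alpha>2 - \<alpha>1 - 1) * exp (- a1 * u / v - a2 * v))"
    and "meijer_G2002 k \<alpha>1 \<alpha>2 (a1 * a2 * u) =
        complex_of_real (a1 powr \<alpha>1 * a2 powr \<alpha>2 * u powr \<alpha>1 *
          (LBINT v:{0<..}. v powr (\<alpha>2 - \<alpha>1 - 1) * exp (- a1 * u / v - a2 * v)))"
proof -
  have z: "a1 * a2 * u > 0" "a1 * a2 * u = a2 * (a1 * u)"
    using assms(1-3) by auto
  have e: "- (a1 * u / v) - a2 * v = - a1 * u / v - a2 * v" for v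
    by simp
  note G = meijer_G2002_eq_Laplace_type_integral[OF z(1) assms(4,5)]
  note S = Laplace_type_integral_scale[OF assms(2) G(1)[unfolded z(2)], unfolded e]
  show "set_integrable lborel {0<..} (\<lambda>v. v powr (\<alpha>2 - \<alpha>1 - 1) * exp (- a1 * u / v - a2 * v))"
    by (rule S(1))
  have "(a1 * a2 * u) powr \<alpha>1 * a2 powr (\<alpha>2 - \<alpha>1) =
        a1 powr \<alpha>1 * (a2 powr \<alpha>1 * a2 powr (\<alpha>2 - \<alpha>1)) * u powr \<alpha>1"
    using assms(1-3) by (simp add: powr_mult mult_ac)
  also have "a2 powr \<alpha>1 * a2 powr (\<alpha>2 - \<alpha>1) = a2 powr \<alpha>2"
    by (simp add: powr_add[symmetric])
  finally have c: "(a1 * a2 * u) powr \<alpha>1 * (a2 powr (\<alpha>2 - \<alpha>1) * x) =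
      a1 powr \<alpha>1 * a2 powr \<alpha>2 * u powr \<alpha>1 * x" for x
    by (simp only: mult.assoc[symmetric])
  show "meijer_G2002 k \<alpha>1 \<alpha>2 (a1 * a2 * u) =
        complex_of_real (a1 powr \<alpha>1 * a2 powr \<alpha>2 * u powr \<alpha>1 *
          (LBINT v:{0<..}. v powr (\<alpha>2 - \<alpha>1 - 1) * exp (- a1 * u / v - a2 * v)))"
    using G(2) unfolding c[symmetric] S(2)[symmetric] z(2) .
qed

lemma meijer_G2002_commute: "meijer_G2002 k \<alpha>1 \<alpha>2 z = meijer_G2002 k \<alpha>2 \<alpha>1 z"
  unfolding meijer_G2002_def meijer_G2002_integrand_def[abs_def] by (simp add: mult.commute mult.left_commute)

theorem theorem2p6:
  fixes a1 a2 \<alpha>1 \<alpha>2 u \<kappa> :: real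
  assumes "a1 > 0" and "a2 > 0"
    and "\<alpha>1 > -1" and "\<alpha>2 > -1"
    and "u > 0"
    and "\<kappa> > max (- \<alpha>1) (- \<alpha>2)"
  shows "vline_integrable \<kappa> (meijer_G2002_integrand \<alpha>1 \<alpha>2 (a1 * a2 * u))
    \<and> set_integrable lborel {0<..} (\<lambda>v. v powr (\<alpha>2 - \<alpha>1 - 1) * exp (- a1 * u / v - a2 * v))
    \<and> set_integrable lborel {0<..} (\<lambda>v. v powr (\<alpha>1 - \<alpha>2 - 1) * exp (- a1 * v - a2 * u / v))
    \<and> meijer_G2002 \<kappa> \<alpha>1 \<alpha>2 (a1 * a2 * u) =
        complex_of_real (a1 powr \<alpha>1 * a2 powr \<alpha>2 * u powr \<alpha>1 *
          (LBINT v:{0<..}. v powr (\<alpha>2 - \<alpha>1 - 1) * exp (- a1 * u / v - a2 * v)))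
    \<and> meijer_G2002 \<kappa> \<alpha>1 \<alpha>2 (a1 * a2 * u) =
        complex_of_real (a1 powr \<alpha>1 * a2 powr \<alpha>2 * u powr \<alpha>2 *
          (LBINT v:{0<..}. v powr (\<alpha>1 - \<alpha>2 - 1) * exp (- a1 * v - a2 * u / v)))
    \<and> ((\<forall>\<nu>::nat. \<alpha>1 - \<alpha>2 \<noteq> real \<nu> \<and> \<alpha>1 - \<alpha>2 \<noteq> - real \<nu>) \<longrightarrow>
        meijer_G2002 \<kappa> \<alpha>1 \<alpha>2 (a1 * a2 * u) =
          complex_of_real
            ((a1 * a2 * u) powr \<alpha>1 * Gamma (\<alpha>2 - \<alpha>1) * hypergeo_0F1 (1 + \<alpha>1 - \<alpha>2) (a1 * a2 * u)
           + (a1 * a2 * u) powr \<alpha>2 * Gamma (\<alpha>1 - \<alpha>2) * hypergeo_0F1 (1 + \<alpha>2 - \<alpha>1) (a1 * a2 * u)))"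
proof -
  have k: "- \<alpha>1 < \<kappa>" "- \<alpha>2 < \<kappa>" and z: "a1 * a2 * u > 0"
    using assms by auto
  have e: "- a2 * u / v - a1 * v = - a1 * v - a2 * u / v" for v
    by simp
  note first = meijer_G2002_eq_scaled_integral[OF assms(1,2,5) k]
  \<comment> \<open>The second representation is the first one with the indices 1 and 2 exchanged.\<close>
  note second = meijer_G2002_eq_scaled_integral[OF assms(2,1,5) k(2,1), unfolded e]
  have second': "meijer_G2002 \<kappa> \<alpha>1 \<alpha>2 (a1 * a2 * u) =
        complex_of_real (a1 powr \<alpha>1 * a2 powr \<alpha>2 * u powr \<alpha>2 *
          (LBINT v:{0<..}. v powr (\<alpha>1 - \<alpha>2 - 1) * exp (- a1 * v - a2 * u / v)))"
    using second(2) unfolding meijer_G2002_commute[of \<kappa> \<alpha>1] by (simp only: mult_ac)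
  have "\<alpha>1 - \<alpha>2 \<notin> \<int>" if "\<forall>\<nu>::nat. \<alpha>1 - \<alpha>2 \<noteq> real \<nu> \<and> \<alpha>1 - \<alpha>2 \<noteq> - real \<nu>"
  proof
    assume "\<alpha>1 - \<alpha>2 \<in> \<int>"
    then obtain m :: int where "\<alpha>1 - \<alpha>2 = of_int m" by (elim Ints_cases)
    with that show False by (cases m rule: int_cases2) auto
  qed
  thus ?thesis
    using vline_integrable_meijer_G2002_integrand[OF z k] first second(1) second'
      meijer_G2002_eq_0F1[OF z k] by blast
qed

end
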